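(* Let $\mathcal{A}$ be a Rickart *-ring. Then each of the binary relations $\preceq^{\ell*|\ell\square}$, $\preceq^{\ell*|r\square}$ and $\preceq^{\ell*|\square}$ on $\mathcal{A}$, defined for $a,b\in\mathcal{A}$ by - $a\preceq^{\ell*|\ell\square} b$ iff $\mathrm{lp}(a)b=a=\mathrm{lp}(b)a$ and $a^2=ab$, - $a\preceq^{\ell*|r\square} b$ iff $\mathrm{lp}(a)b=a=\mathrm{lp}(b)a$ and $a^2=ba$, - $a\preceq^{\ell*|\square} b$ iff $\mathrm{lp}(a)b=a=\mathrm{lp}(b)a$ and $a^2=ab=ba$, is a partial order on $\mathcal{A}$.
   Context: A *-ring is an (associative) ring $\mathcal{A}$ with an involution $*$: $(a+b)^*=a^*+b^*$, $(ab)^*=b^*a^*$, $(a^* )^*=a$. It is a Rickart *-ring if for every $a\in\mathcal{A}$ there is a self-adjoint idempotent $p$ (i.e. $p=p^*=p^2$) with $\{x\in\mathcal{A}: xa=0\}=\mathcal{A}(1-p)$; such a ring has an identity $1$, and $p$ is unique and denoted $\mathrm{lp}(a)$. Likewise, for every $a$ there is a unique self-adjoint idempotent $\mathrm{rp}(a)$ with $\{x\in\mathcal{A}: ax=0\}=(1-\mathrm{rp}(a))\mathcal{A}$. *)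

theory Defs
  imports "HOL-Algebra.Ring"
begin

locale star_ring = ring R for R (structure) +
  fixes star :: "'a \<Rightarrow> 'a"
  assumes star_closed: "a \<in> carrier R \<Longrightarrow> star a \<in> carrier R"
    and star_add: "\<lbrakk>a \<in> carrier R; b \<in> carrier R\<rbrakk> \<Longrightarrow> star (a \<oplus> b) = star a \<oplus> star b"
    and star_mult: "\<lbrakk>a \<in> carrier R; b \<in> carrier R\<rbrakk> \<Longrightarrow> star (a \<otimes> b) = star b \<otimes> star a"
    and star_star: "a \<in> carrier R \<Longrightarrow> star (star a) = a"

definition projection :: "('a, 'm) ring_scheme \<Rightarrow> ('a \<Rightarrow> 'a) \<Rightarrow> 'a \<Rightarrow> bool" where
  "projection R star p \<longleftrightarrow> p \<in> carrier R \<and> star p = p \<and> p \<otimes>\<^bsub>R\<^esub> p = p"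

definition left_annihilator :: "('a, 'm) ring_scheme \<Rightarrow> 'a \<Rightarrow> 'a set" where
  "left_annihilator R a = {x \<in> carrier R. x \<otimes>\<^bsub>R\<^esub> a = \<zero>\<^bsub>R\<^esub>}"

definition left_multiples :: "('a, 'm) ring_scheme \<Rightarrow> 'a \<Rightarrow> 'a set" where
  "left_multiples R c = {y \<otimes>\<^bsub>R\<^esub> c | y. y \<in> carrier R}"

definition is_lp :: "('a, 'm) ring_scheme \<Rightarrow> ('a \<Rightarrow> 'a) \<Rightarrow> 'a \<Rightarrow> 'a \<Rightarrow> bool" where
  "is_lp R star a p \<longleftrightarrow>
     projection R star p \<and> left_annihilator R a = left_multiples R (\<one>\<^bsub>R\<^esub> \<ominus>\<^bsub>R\<^esub> p)"

definition lp :: "('a, 'm) ring_scheme \<Rightarrow> ('a \<Rightarrow> 'a) \<Rightarrow> 'a \<Rightarrow> 'a" where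
  "lp R star a = (THE p. is_lp R star a p)"

text \<open>
  The identity is part of the structure \<open>ring\<close>: the defining condition
  \<open>{x. xa = 0} = A(1 - p)\<close> already refers to it. The trivial ring is allowed.
\<close>

locale rickart_star_ring = star_ring +
  assumes rickart: "a \<in> carrier R \<Longrightarrow> \<exists>p. is_lp R star a p"
begin

lemma is_lp_unique:
  assumes p: "is_lp R star a p" and q: "is_lp R star a q"
  shows "p = q"
proof -
  have absorb: "s = r \<otimes> s" if r: "is_lp R star a r" and s: "is_lp R star a s" for r s
  proof -
    have rs: "r \<in> carrier R" "s \<in> carrier R" "s \<otimes> s = s"
      using r s by (auto simp: is_lp_def projection_def)
    have "\<one> \<ominus> r \<in> left_multiples R (\<one> \<ominus> r)"
      unfolding left_multiples_def using rs by (auto intro!: exI[of _ "\<one>"])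
    then have "\<one> \<ominus> r \<in> left_multiples R (\<one> \<ominus> s)"
      using r s by (simp add: is_lp_def)
    then obtain y where y: "y \<in> carrier R" "\<one> \<ominus> r = y \<otimes> (\<one> \<ominus> s)"
      by (auto simp: left_multiples_def)
    have "(\<one> \<ominus> s) \<otimes> s = \<zero>"
      using rs by (simp add: minus_eq l_distr l_minus r_neg)
    then have "(\<one> \<ominus> r) \<otimes> s = \<zero>"
      using y rs by (simp add: m_assoc)
    then have "s \<ominus> r \<otimes> s = \<zero>"
      using rs by (simp add: minus_eq l_distr l_minus)
    then show ?thesis
      using rs minus_equality[of s "\<ominus> (r \<otimes> s)"] by (simp add: minus_eq)
  qed
  have pq: "p \<in> carrier R" "q \<in> carrier R" "star p = p" "star q = q"
    using p q by (auto simp: is_lp_def projection_def)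
  have "p = star (q \<otimes> p)"
    using absorb[OF q p] pq by simp
  also have "\<dots> = p \<otimes> q"
    using pq by (simp add: star_mult)
  also have "\<dots> = q"
    using absorb[OF p q] by simp
  finally show ?thesis .
qed

lemma lp_is_lp: "a \<in> carrier R \<Longrightarrow> is_lp R star a (lp R star a)"
  unfolding lp_def using rickart is_lp_unique by (metis theI)

end

definition le_lstar_lsquare :: "('a, 'm) ring_scheme \<Rightarrow> ('a \<Rightarrow> 'a) \<Rightarrow> 'a rel" where
  "le_lstar_lsquare R star =
     {(a, b) \<in> carrier R \<times> carrier R.
        lp R star a \<otimes>\<^bsub>R\<^esub> b = a \<and> a = lp R star b \<otimes>\<^bsub>R\<^esub> a \<and>
        a [^]\<^bsub>R\<^esub> (2::nat) = a \<otimes>\<^bsub>R\<^esub> b}"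

definition le_lstar_rsquare :: "('a, 'm) ring_scheme \<Rightarrow> ('a \<Rightarrow> 'a) \<Rightarrow> 'a rel" where
  "le_lstar_rsquare R star =
     {(a, b) \<in> carrier R \<times> carrier R.
        lp R star a \<otimes>\<^bsub>R\<^esub> b = a \<and> a = lp R star b \<otimes>\<^bsub>R\<^esub> a \<and>
        a [^]\<^bsub>R\<^esub> (2::nat) = b \<otimes>\<^bsub>R\<^esub> a}"

definition le_lstar_square :: "('a, 'm) ring_scheme \<Rightarrow> ('a \<Rightarrow> 'a) \<Rightarrow> 'a rel" where
  "le_lstar_square R star =
     {(a, b) \<in> carrier R \<times> carrier R.
        lp R star a \<otimes>\<^bsub>R\<^esub> b = a \<and> a = lp R star b \<otimes>\<^bsub>R\<^esub> a \<and>
        a [^]\<^bsub>R\<^esub> (2::nat) = a \<otimes>\<^bsub>R\<^esub> b \<and> a \<otimes>\<^bsub>R\<^esub> b = b \<otimes>\<^bsub>R\<^esub> a}"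

end

theory Submission
  imports Defs "HOL-Algebra.Multiplicative_Group"
begin

text \<open>
  The condition \<open>lp(b) a = a\<close> just says \<open>lp(a) = lp(b) lp(a) = lp(a) lp(b)\<close>, that is,
  \<open>lp(a) \<le> lp(b)\<close> as projections, which gives the transitivity of the first two conditions.
  Antisymmetry is immediate: if the relation holds both ways then \<open>a = lp(b) a = b\<close>.

  For the products, suppose \<open>a \<preceq> b \<preceq> c\<close>. As \<open>a = lp(a) b\<close>, \<open>b\<^sup>2 = bc\<close> gives \<open>ab = lp(a) b\<^sup>2 = ac\<close>.
  On the other side, \<open>b\<^sup>2 = cb\<close> says that \<open>b - c\<close> left-annihilates \<open>b\<close>, hence also \<open>lp(b)\<close>,
  so \<open>ba = b lp(b) a = c lp(b) a = ca\<close>.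
\<close>

context rickart_star_ring
begin

lemma lp_closed [simp]: "a \<in> carrier R \<Longrightarrow> lp R star a \<in> carrier R"
  and star_lp: "a \<in> carrier R \<Longrightarrow> star (lp R star a) = lp R star a"
  and lp_idem: "a \<in> carrier R \<Longrightarrow> lp R star a \<otimes> lp R star a = lp R star a"
  using lp_is_lp by (auto simp: is_lp_def projection_def)

text \<open>The left annihilator of \<open>a\<close> is the set of left multiples of
  \<open>1 - p\<close> with \<open>p = lp(a)\<close>, and since \<open>p\<close> is idempotent these
  are exactly the \<open>x\<close> with \<open>xp = 0\<close>.\<close>

lemma mult_eq_zero_iff_mult_lp:
  assumes a: "a \<in> carrier R" and x: "x \<in> carrier R"
  shows "x \<otimes> a = \<zero> \<longleftrightarrow> x \<otimes> lp R star a = \<zero>"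
proof -
  let ?p = "lp R star a"
  have p: "?p \<in> carrier R" "?p \<otimes> ?p = ?p"
    using a lp_idem by auto
  have "x \<otimes> a = \<zero> \<longleftrightarrow> x \<in> left_multiples R (\<one> \<ominus> ?p)"
    using lp_is_lp[OF a] x by (auto simp: is_lp_def left_annihilator_def)
  also have "\<dots> \<longleftrightarrow> x \<otimes> ?p = \<zero>"
  proof
    assume "x \<in> left_multiples R (\<one> \<ominus> ?p)"
    then obtain y where y: "y \<in> carrier R" "x = y \<otimes> (\<one> \<ominus> ?p)"
      by (auto simp: left_multiples_def)
    have "(\<one> \<ominus> ?p) \<otimes> ?p = \<zero>"
      using p by (simp add: minus_eq l_distr l_minus r_neg)
    then show "x \<otimes> ?p = \<zero>"
      using y p by (simp add: m_assoc)
  next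
    assume "x \<otimes> ?p = \<zero>"
    \<comment> \<open>So \<open>x\<close> itself serves as the coefficient of
      \<open>1 - p\<close>.\<close>
    then have "x = x \<otimes> (\<one> \<ominus> ?p)"
      using x p by (simp add: minus_eq r_distr r_minus)
    then show "x \<in> left_multiples R (\<one> \<ominus> ?p)"
      unfolding left_multiples_def using x by blast
  qed
  finally show ?thesis .
qed

text \<open>The annihilator criterion applied to \<open>x - y\<close>. With \<open>y = 1\<close> it
  says that \<open>x\<close> fixes \<open>a\<close> from the left iff it fixes
  \<open>lp(a)\<close>.\<close>

lemma mult_eq_iff_mult_lp:
  assumes "a \<in> carrier R" "x \<in> carrier R" "y \<in> carrier R"
  shows "x \<otimes> a = y \<otimes> a \<longleftrightarrow> x \<otimes> lp R star a = y \<otimes> lp R star a"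
proof -
  have "x \<otimes> c = y \<otimes> c \<longleftrightarrow> (x \<ominus> y) \<otimes> c = \<zero>" if "c \<in> carrier R" for c
    using assms that by (simp add: minus_eq l_distr l_minus flip: r_right_minus_eq[of "x \<otimes> c"])
  then show ?thesis
    using assms mult_eq_zero_iff_mult_lp[of a "x \<ominus> y"] by simp
qed

lemma lp_mult_self: "a \<in> carrier R \<Longrightarrow> lp R star a \<otimes> a = a"
  using mult_eq_iff_mult_lp[of a "lp R star a" \<one>] by (simp add: lp_idem)

text \<open>The first equation transfers the hypothesis from \<open>a\<close> to
  \<open>lp(a)\<close>; the second is its image under the involution, as projections are
  self-adjoint.\<close>

lemma lp_mult_lp:
  assumes a: "a \<in> carrier R" and b: "b \<in> carrier R" and eq: "lp R star b \<otimes> a = a"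
  shows "lp R star b \<otimes> lp R star a = lp R star a" "lp R star a \<otimes> lp R star b = lp R star a"
proof -
  show *: "lp R star b \<otimes> lp R star a = lp R star a"
    using mult_eq_iff_mult_lp[of a "lp R star b" \<one>] a b eq by simp
  have "star (lp R star b \<otimes> lp R star a) = lp R star a \<otimes> lp R star b"
    using a b by (simp add: star_mult star_lp)
  with * show "lp R star a \<otimes> lp R star b = lp R star a"
    using a by (simp add: star_lp)
qed

lemma lp_conditions_trans:
  assumes abc: "a \<in> carrier R" "b \<in> carrier R" "c \<in> carrier R"
    and ab: "lp R star a \<otimes> b = a" "lp R star b \<otimes> a = a"
    and bc: "lp R star b \<otimes> c = b" "lp R star c \<otimes> b = b"
  shows "lp R star a \<otimes> c = a" "lp R star c \<otimes> a = a"
proof -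
  \<comment> \<open>Inserting \<open>lp(b)\<close> lets it absorb \<open>c\<close> into
    \<open>b\<close>, leaving \<open>lp(a) b = a\<close>.\<close>
  have "lp R star a \<otimes> c = lp R star a \<otimes> lp R star b \<otimes> c"
    using lp_mult_lp(2)[of a b] abc ab by simp
  also have "\<dots> = a"
    using abc ab bc by (simp add: m_assoc)
  finally show "lp R star a \<otimes> c = a" .
  have "lp R star c \<otimes> (lp R star b \<otimes> a) = lp R star b \<otimes> a"
    using lp_mult_lp(1)[of b c] abc bc by (simp flip: m_assoc)
  then show "lp R star c \<otimes> a = a"
    using ab by simp
qed

lemma right_mult_eq:
  assumes abc: "a \<in> carrier R" "b \<in> carrier R" "c \<in> carrier R"
    and ab: "lp R star a \<otimes> b = a" and bc: "b \<otimes> b = b \<otimes> c"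
  shows "a \<otimes> b = a \<otimes> c"
proof -
  have "lp R star a \<otimes> b \<otimes> b = lp R star a \<otimes> b \<otimes> c"
    using abc bc by (simp add: m_assoc)
  then show ?thesis
    using ab by simp
qed

lemma left_mult_eq:
  assumes abc: "a \<in> carrier R" "b \<in> carrier R" "c \<in> carrier R"
    and ab: "lp R star b \<otimes> a = a" and bc: "b \<otimes> b = c \<otimes> b"
  shows "b \<otimes> a = c \<otimes> a"
proof -
  \<comment> \<open>The passage from \<open>b\<close> to \<open>lp(b)\<close> is made because
    \<open>a\<close> factors as \<open>lp(b) a\<close>.\<close>
  have "b \<otimes> lp R star b = c \<otimes> lp R star b"
    using mult_eq_iff_mult_lp abc bc by blast
  then have "b \<otimes> (lp R star b \<otimes> a) = c \<otimes> (lp R star b \<otimes> a)"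
    using abc by (simp flip: m_assoc)
  then show ?thesis
    using ab by simp
qed

lemma mem_le_lstar_lsquare_iff:
  "(a, b) \<in> le_lstar_lsquare R star \<longleftrightarrow> a \<in> carrier R \<and> b \<in> carrier R \<and>
     lp R star a \<otimes> b = a \<and> lp R star b \<otimes> a = a \<and> a \<otimes> a = a \<otimes> b"
  by (auto simp: le_lstar_lsquare_def numeral_2_eq_2)

lemma mem_le_lstar_rsquare_iff:
  "(a, b) \<in> le_lstar_rsquare R star \<longleftrightarrow> a \<in> carrier R \<and> b \<in> carrier R \<and>
     lp R star a \<otimes> b = a \<and> lp R star b \<otimes> a = a \<and> a \<otimes> a = b \<otimes> a"
  by (auto simp: le_lstar_rsquare_def numeral_2_eq_2)

text \<open>Reduces the two-sided relation to the one-sided ones.\<close>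

lemma le_lstar_square_eq_Int:
  "le_lstar_square R star = le_lstar_lsquare R star \<inter> le_lstar_rsquare R star"
  by (auto simp: le_lstar_square_def le_lstar_lsquare_def le_lstar_rsquare_def)

lemma partial_order_on_le_lstar_lsquare: "partial_order_on (carrier R) (le_lstar_lsquare R star)"
  unfolding partial_order_on_def preorder_on_def
proof (intro conjI)
  show "le_lstar_lsquare R star \<subseteq> carrier R \<times> carrier R"
    by (auto simp: mem_le_lstar_lsquare_iff)
  show "refl_on (carrier R) (le_lstar_lsquare R star)"
    by (auto simp: refl_on_def mem_le_lstar_lsquare_iff lp_mult_self)
  show "trans (le_lstar_lsquare R star)"
    unfolding trans_def mem_le_lstar_lsquare_iff
    \<comment> \<open>The product condition is the chain \<open>aa = ab = ac\<close>.\<close>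
    using lp_conditions_trans right_mult_eq by metis
  show "antisym (le_lstar_lsquare R star)"
    unfolding antisym_def mem_le_lstar_lsquare_iff by metis
qed

lemma partial_order_on_le_lstar_rsquare: "partial_order_on (carrier R) (le_lstar_rsquare R star)"
  unfolding partial_order_on_def preorder_on_def
proof (intro conjI)
  show "le_lstar_rsquare R star \<subseteq> carrier R \<times> carrier R"
    by (auto simp: mem_le_lstar_rsquare_iff)
  show "refl_on (carrier R) (le_lstar_rsquare R star)"
    by (auto simp: refl_on_def mem_le_lstar_rsquare_iff lp_mult_self)
  show "trans (le_lstar_rsquare R star)"
    unfolding trans_def mem_le_lstar_rsquare_iff
    using lp_conditions_trans left_mult_eq by metis
  show "antisym (le_lstar_rsquare R star)"
    unfolding antisym_def mem_le_lstar_rsquare_iff by metis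
qed

end

text \<open>Reflexivity and transitivity survive intersection, and antisymmetry passes to
  subrelations.\<close>

lemma partial_order_on_Int:
  assumes "partial_order_on A r" "partial_order_on A s"
  shows "partial_order_on A (r \<inter> s)"
  using assms
  by (auto simp: partial_order_on_def preorder_on_def refl_on_def intro: trans_Int antisym_subset)

theorem theorem9:
  fixes R :: "('a, 'm) ring_scheme" and star :: "'a \<Rightarrow> 'a"
  assumes "rickart_star_ring R star"
  shows "partial_order_on (carrier R) (le_lstar_lsquare R star) \<and>
         partial_order_on (carrier R) (le_lstar_rsquare R star) \<and>
         partial_order_on (carrier R) (le_lstar_square R star)"
proof -
  interpret rickart_star_ring R star
    by fact
  show ?thesis
    by (simp add: le_lstar_square_eq_Int partial_order_on_Int
        partial_order_on_le_lstar_lsquare partial_order_on_le_lstar_rsquare)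
qed

end
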